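(* Let $x_{t+1}=T(x_t)$ be a $G$-equivariant discrete-time dynamical system on $M\subset\mathbb{R}^n$, and let $\mathbb{U}:\mathcal{F}(M)\to\mathcal{F}(M)$ be its associated Koopman operator. Then $$[g\star(\mathbb{U}f)](x)=[\mathbb{U}(g\star f)](x)$$ for all $g\in G$, all $f\in\mathcal{F}(M)$ and all $x\in M$.
   Context: Standing assumptions: $G$ is a finite subgroup of $O(n)$, $M\subset\mathbb{R}^n$ is a compact $G$-invariant set, $G$ acts on $M$ by matrix multiplication (written $g\cdot x$), and $T:M\to M$ is at least $C^1$. The system $x_{t+1}=T(x_t)$ is $G$-equivariant if $T(g\cdot x)=g\cdot T(x)$ for all $g\in G$, $x\in M$. $\mathcal{F}(M)$ is a vector space of functions (observables) on $M$ that is mapped into itself by the Koopman operator $\mathbb{U}$, defined by $[\mathbb{U}h](x)=h(T(x))$, and on which $G$ acts by $(g\star f)(x)=f(g^{-1}\cdot x)$ (so $g\star f\in\mathcal{F}(M)$ whenever $f\in\mathcal{F}(M)$). *)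

theory Defs
  imports "HOL-Analysis.Analysis" "HOL-Algebra.Group"
begin

definition orthogonal_group :: "(real ^ 'n ^ 'n) monoid" where
  "orthogonal_group =
     \<lparr>carrier = {A. orthogonal_matrix A}, monoid.mult = (\<lambda>A B. A ** B), one = mat 1\<rparr>"

lemma group_orthogonal_group: "group (orthogonal_group :: (real ^ 'n ^ 'n) monoid)"
proof (rule groupI)
  fix A :: "real ^ 'n ^ 'n"
  assume "A \<in> carrier orthogonal_group"
  then show "\<exists>B\<in>carrier orthogonal_group. B \<otimes>\<^bsub>orthogonal_group\<^esub> A = \<one>\<^bsub>orthogonal_group\<^esub>"
    by (intro bexI[of _ "transpose A"]) (auto simp: orthogonal_group_def orthogonal_matrix_def)
qed (auto simp: orthogonal_group_def orthogonal_matrix_mul orthogonal_matrix_id matrix_mul_assoc)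

definition invariant_under :: "(real ^ 'n ^ 'n) set \<Rightarrow> (real ^ 'n) set \<Rightarrow> bool" where
  "invariant_under G M \<longleftrightarrow> (\<forall>g\<in>G. \<forall>x\<in>M. g *v x \<in> M)"

definition equivariant_on ::
  "(real ^ 'n ^ 'n) set \<Rightarrow> (real ^ 'n) set \<Rightarrow> (real ^ 'n \<Rightarrow> real ^ 'n) \<Rightarrow> bool" where
  "equivariant_on G M T \<longleftrightarrow> (\<forall>g\<in>G. \<forall>x\<in>M. T (g *v x) = g *v T x)"

text \<open>The set \<open>M\<close> need not be open, so being \<open>C\<^sup>1\<close> on \<open>M\<close> means being the restriction to \<open>M\<close>
  of a \<open>C\<^sup>1\<close> map defined on an open neighbourhood of \<open>M\<close>.\<close>

definition C1_map_on ::
  "'a::real_normed_vector set \<Rightarrow> ('a \<Rightarrow> 'b::real_normed_vector) \<Rightarrow> bool" where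
  "C1_map_on M T \<longleftrightarrow>
     (\<exists>U F F'. open U \<and> M \<subseteq> U \<and> (\<forall>x\<in>M. F x = T x) \<and>
        (\<forall>x\<in>U. (F has_derivative blinfun_apply (F' x)) (at x)) \<and> continuous_on U F')"

text \<open>Functions on \<open>M\<close> are represented by elements of \<^term>\<open>extensional M\<close>, that is, by total
  functions taking the value \<^term>\<open>undefined\<close> outside \<open>M\<close>, so that equality of representatives
  is equality on \<open>M\<close>. The values lie in a vector space with scalar multiplication \<open>smul\<close>; this
  covers real, complex and vector-valued observables.\<close>

definition function_space_on ::
  "('k::field \<Rightarrow> 'b::ab_group_add \<Rightarrow> 'b) \<Rightarrow> 'a set \<Rightarrow> ('a \<Rightarrow> 'b) set \<Rightarrow> bool" where
  "function_space_on smul M \<F> \<longleftrightarrow>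
     vector_space smul \<and> \<F> \<subseteq> extensional M \<and>
     (\<lambda>x\<in>M. 0) \<in> \<F> \<and>
     (\<forall>f\<in>\<F>. \<forall>h\<in>\<F>. (\<lambda>x\<in>M. f x + h x) \<in> \<F>) \<and>
     (\<forall>c. \<forall>f\<in>\<F>. (\<lambda>x\<in>M. smul c (f x)) \<in> \<F>)"

text \<open>Both operators below have domain \<open>\<F>\<close>; that they map \<open>\<F>\<close> into itself is a separate
  property.\<close>

definition koopman ::
  "('a \<Rightarrow> 'b) set \<Rightarrow> 'a set \<Rightarrow> ('a \<Rightarrow> 'a) \<Rightarrow> ('a \<Rightarrow> 'b) \<Rightarrow> 'a \<Rightarrow> 'b" where
  "koopman \<F> M T = (\<lambda>h\<in>\<F>. \<lambda>x\<in>M. h (T x))"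

definition observable_action ::
  "(real ^ 'n \<Rightarrow> 'b) set \<Rightarrow> (real ^ 'n) set \<Rightarrow> real ^ 'n ^ 'n \<Rightarrow>
     (real ^ 'n \<Rightarrow> 'b) \<Rightarrow> real ^ 'n \<Rightarrow> 'b" where
  "observable_action \<F> M g = (\<lambda>f\<in>\<F>. \<lambda>x\<in>M. f (matrix_inv g *v x))"

end

theory Submission imports Defs begin

text \<open>Both sides evaluate \<open>f\<close> at a point: the left at
  \<open>T (matrix_inv g *v x)\<close>, the right at \<open>matrix_inv g *v T x\<close>.
  Equivariance, applied to the inverse of \<open>g\<close>, makes the two points equal. This
  requires \<open>matrix_inv g\<close> to lie in \<open>G\<close>, which
  \<open>matrix_inv_in_subgroup\<close> supplies.\<close>

lemma matrix_inv_eqI: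
  fixes A :: "'a::semiring_1 ^ 'n ^ 'm"
  assumes "A ** B = mat 1" and "B ** A = mat 1"
  shows "matrix_inv A = B"
proof -
  \<comment> \<open>\<open>matrix_inv\<close> is a Hilbert choice among two-sided inverses;
    \<open>B\<close> shows that one exists, and associativity then forces uniqueness.\<close>
  have "A ** matrix_inv A = mat 1 \<and> matrix_inv A ** A = mat 1"
    unfolding matrix_inv_def by (rule someI[of _ B]) (use assms in simp)
  then show ?thesis
    using assms by (metis matrix_mul_assoc matrix_mul_lid matrix_mul_rid)
qed

text \<open>Subgroups are closed under the abstract group inverse, which in
  \<open>orthogonal_group\<close> is a two-sided matrix inverse and hence equals
  \<open>matrix_inv\<close>.\<close>

lemma matrix_inv_in_subgroup:
  fixes G :: "(real ^ 'n ^ 'n) set"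
  assumes "subgroup G orthogonal_group" and "g \<in> G"
  shows "matrix_inv g \<in> G"
proof -
  interpret group "orthogonal_group :: (real ^ 'n ^ 'n) monoid"
    by (rule group_orthogonal_group)
  let ?h = "inv\<^bsub>orthogonal_group\<^esub> g"
  have g: "g \<in> carrier orthogonal_group"
    using assms by (rule subgroup.mem_carrier)
  have "matrix_inv g = ?h"
    using r_inv[OF g] l_inv[OF g]
    by (intro matrix_inv_eqI) (simp_all add: orthogonal_group_def)
  then show ?thesis
    using assms by (simp add: subgroup.m_inv_closed)
qed

theorem theorem1:
  fixes G :: "(real ^ 'n ^ 'n) set"
    and M :: "(real ^ 'n) set"
    and T :: "real ^ 'n \<Rightarrow> real ^ 'n"
    and smul :: "'k::field \<Rightarrow> 'b::ab_group_add \<Rightarrow> 'b"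
    and \<F> :: "(real ^ 'n \<Rightarrow> 'b) set"
  assumes "finite G" and "subgroup G orthogonal_group"
    and "compact M" and "invariant_under G M"
    and "T \<in> M \<rightarrow> M" and "C1_map_on M T" and "equivariant_on G M T"
    and "function_space_on smul M \<F>"
    and "koopman \<F> M T \<in> \<F> \<rightarrow> \<F>"
    and "\<forall>g\<in>G. observable_action \<F> M g \<in> \<F> \<rightarrow> \<F>"
  shows "\<forall>g\<in>G. \<forall>f\<in>\<F>. \<forall>x\<in>M.
           observable_action \<F> M g (koopman \<F> M T f) x
             = koopman \<F> M T (observable_action \<F> M g f) x"
proof (intro ballI)
  fix g f x
  assume g: "g \<in> G" and f: "f \<in> \<F>" and x: "x \<in> M"
  have inv: "matrix_inv g \<in> G"
    using \<open>subgroup G orthogonal_group\<close> g by (rule matrix_inv_in_subgroup)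
  \<comment> \<open>Both operators are \<open>undefined\<close> off \<open>\<F>\<close>, so the
    outer one can be unfolded only once the inner result is known to lie in
    \<open>\<F>\<close>.\<close>
  have Uf: "koopman \<F> M T f \<in> \<F>" and gf: "observable_action \<F> M g f \<in> \<F>"
    using assms(9,10) f g by auto
  \<comment> \<open>Likewise, observables produced by the operators follow their formulas only at
    points of \<open>M\<close>.\<close>
  have inv_x: "matrix_inv g *v x \<in> M" and Tx: "T x \<in> M"
    using assms(4,5) inv x by (auto simp: invariant_under_def)
  have "observable_action \<F> M g (koopman \<F> M T f) x = koopman \<F> M T f (matrix_inv g *v x)"
    using Uf x by (simp add: observable_action_def)
  also have "\<dots> = f (T (matrix_inv g *v x))"
    using f inv_x by (simp add: koopman_def)
  \<comment> \<open>Equivariance for the group element \<open>matrix_inv g\<close>, at the point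
    \<open>x\<close>.\<close>
  also have "\<dots> = f (matrix_inv g *v T x)"
    using assms(7) inv x by (simp add: equivariant_on_def)
  also have "\<dots> = observable_action \<F> M g f (T x)"
    using f Tx by (simp add: observable_action_def)
  also have "\<dots> = koopman \<F> M T (observable_action \<F> M g f) x"
    using gf x by (simp add: koopman_def)
  finally show "observable_action \<F> M g (koopman \<F> M T f) x
    = koopman \<F> M T (observable_action \<F> M g f) x" .
qed

end
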